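(* Let $X$ be a Banach space, $p\in\mathbb{N}$, and let $T:X\rightrightarrows X^*$ be a linear operator. The following hold. (1) If $T$ is maximal $p$-monotone then $T(0)=\mathrm{dom}(T)^{\perp}$. (2) If $T$ is $p$-monotone with closed domain and $T(0)=\mathrm{dom}(T)^{\perp}$, then $T$ is maximal monotone and, in particular, maximal $p$-monotone.
   Context: $X$ is a real Banach space with topological dual $X^*$ and duality product $\langle x,x^*\rangle$. $\mathbb{N}=\{1,2,\dots\}$. A multivalued operator $T:X\rightrightarrows X^*$ assigns to each $x\in X$ a subset $T(x)\subset X^*$ (possibly empty); it is identified with its graph $\{(x,x^* ): x^*\in T(x)\}\subset X\times X^*$, so $(x,x^* )\in T$ means $x^*\in T(x)$ and inclusion of operators means inclusion of graphs. Its domain is $\mathrm{dom}(T)=\{x: T(x)\neq\emptyset\}$. $T$ is linear if its graph is a linear subspace of $X\times X^*$. For $A\subset X$, $A^\perp=\{x^*\in X^*: \langle x,x^*\rangle=0\ \forall x\in A\}$. $T$ is $p$-monotone if for every $(x_0,x_0^* ),\dots,(x_p,x_p^* )\in T$ (not necessarily distinct), with $x_{p+1}=x_0$, one has $\sum_{i=0}^p\langle x_{i+1}-x_i,x_i^*\rangle\le 0$. $T$ is maximal $p$-monotone if it is $p$-monotone and every $p$-monotone operator $S\supset T$ equals $T$. Monotone and maximal monotone mean $1$-monotone and maximal $1$-monotone (monotone: $\langle x-y,x^*-y^*\rangle\ge 0$ for all $(x,x^* ),(y,y^* )\in T$). *)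

theory Defs
  imports "HOL-Analysis.Analysis"
begin

text \<open>
  A multivalued operator from \<open>X\<close> to its topological dual is identified with its graph. Hence
  \<open>T(x)\<close> is \<open>T `` {x}\<close>, \<open>dom(T)\<close> is \<open>Domain T\<close>, inclusion of operators is set inclusion, and
  \<open>T\<close> is linear iff \<open>subspace T\<close>.
\<close>

type_synonym 'a dual = "'a \<Rightarrow>\<^sub>L real"

type_synonym 'a operator = "('a \<times> 'a dual) set"

definition annihilator :: "'a::real_normed_vector set \<Rightarrow> 'a dual set" where
  "annihilator A = {x'. \<forall>x\<in>A. blinfun_apply x' x = 0}"

definition p_monotone :: "nat \<Rightarrow> 'a::real_normed_vector operator \<Rightarrow> bool" where
  "p_monotone p T \<longleftrightarrow>
    (\<forall>x x'. (\<forall>i\<le>p. (x i, x' i) \<in> T) \<and> x (Suc p) = x 0 \<longrightarrow>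
      (\<Sum>i=0..p. blinfun_apply (x' i) (x (Suc i) - x i)) \<le> 0)"

definition maximal_p_monotone :: "nat \<Rightarrow> 'a::real_normed_vector operator \<Rightarrow> bool" where
  "maximal_p_monotone p T \<longleftrightarrow>
    p_monotone p T \<and> (\<forall>S. p_monotone p S \<and> T \<subseteq> S \<longrightarrow> S = T)"

definition maximal_monotone :: "'a::real_normed_vector operator \<Rightarrow> bool" where
  "maximal_monotone T \<longleftrightarrow> maximal_p_monotone 1 T"

lemma p_monotone_1_iff:
  "p_monotone 1 T \<longleftrightarrow>
    (\<forall>x x' y y'. (x, x') \<in> T \<and> (y, y') \<in> T \<longrightarrow> blinfun_apply (x' - y') (x - y) \<ge> 0)"
proof
  assume T: "p_monotone 1 T"
  show "\<forall>x x' y y'. (x, x') \<in> T \<and> (y, y') \<in> T \<longrightarrow> blinfun_apply (x' - y') (x - y) \<ge> 0"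
  proof (intro allI impI)
    fix x x' y y' assume "(x, x') \<in> T \<and> (y, y') \<in> T"
    then have "(\<Sum>i=0..1. blinfun_apply ((if i = 1 then y' else x'))
        ((if Suc i = 1 then y else x) - (if i = 1 then y else x))) \<le> 0"
      by (intro T[unfolded p_monotone_def, rule_format,
          of "\<lambda>i. if i = 1 then y else x" "\<lambda>i. if i = 1 then y' else x'"]) auto
    then show "blinfun_apply (x' - y') (x - y) \<ge> 0"
      by (simp add: blinfun.diff_left blinfun.diff_right)
  qed
next
  assume T: "\<forall>x x' y y'. (x, x') \<in> T \<and> (y, y') \<in> T \<longrightarrow> blinfun_apply (x' - y') (x - y) \<ge> 0"
  show "p_monotone 1 T"
    unfolding p_monotone_def
  proof (intro allI impI)
    fix x x' assume "(\<forall>i\<le>1. (x i, x' i) \<in> T) \<and> x (Suc 1) = x 0"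
    then show "(\<Sum>i=0..1. blinfun_apply (x' i) (x (Suc i) - x i)) \<le> 0"
      using T[rule_format, of "x 0" "x' 0" "x 1" "x' 1"]
      by (simp add: blinfun.diff_left blinfun.diff_right)
  qed
qed

end

theory Submission
  imports Defs
begin

text \<open>
  For \<open>p \<ge> 1\<close>, a cycle that jumps from one point to another and then stays there shows that
  \<open>p\<close>-monotonicity implies monotonicity. Together with linearity, this allows perturbing a point of
  the graph along a line in the graph, and an inequality that holds along a whole line forces its
  first-order coefficient to vanish. All annihilation relations come from this remark.

  For (1), the remark gives \<open>T(0) \<subseteq> dom(T)\<^sup>\<bottom>\<close>. Conversely, adding elements of \<open>dom(T)\<^sup>\<bottom>\<close> to
  the values of \<open>T\<close> does not change the sums in the definition of \<open>p\<close>-monotonicity, since these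
  only pair the values with differences of points of the domain; so a maximal \<open>T\<close> already
  contains \<open>{0} \<times> dom(T)\<^sup>\<bottom>\<close>.

  For (2), let \<open>(x, x')\<close> be monotonically related to all of \<open>T\<close>. Comparing it with the points
  \<open>(0, t y')\<close>, where \<open>y' \<in> T(0) = dom(T)\<^sup>\<bottom>\<close>, shows that \<open>x\<close> is killed by every functional that
  vanishes on \<open>dom(T)\<close>; as \<open>dom(T)\<close> is closed, the Hahn-Banach theorem yields \<open>x \<in> dom(T)\<close>.
  Pick \<open>x\<^sub>0' \<in> T(x)\<close>. Comparing \<open>(x, x')\<close> with points of \<open>T\<close> on lines through \<open>(x, x\<^sub>0')\<close> shows
  that \<open>x' - x\<^sub>0'\<close> lies in \<open>dom(T)\<^sup>\<bottom> = T(0)\<close>, so \<open>(x, x') \<in> T\<close>. Hence \<open>T\<close> is maximal monotone, and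
  since \<open>p\<close>-monotone extensions are monotone it is also maximal \<open>p\<close>-monotone.

  The Hahn-Banach theorem is derived from Zorn's lemma by way of minimal sublinear functionals:
  a minimal one is linear, because lowering it in the direction of any point \<open>y\<close> cannot change it.
\<close>

section \<open>Sublinear functionals\<close>

definition sublinear :: "('a::real_vector \<Rightarrow> real) \<Rightarrow> bool" where
  "sublinear q \<longleftrightarrow>
    (\<forall>x y. q (x + y) \<le> q x + q y) \<and> (\<forall>c x. c \<ge> 0 \<longrightarrow> q (c *\<^sub>R x) = c * q x)"

lemma sublinear_add: "sublinear q \<Longrightarrow> q (x + y) \<le> q x + q y"
  by (simp add: sublinear_def)

lemma sublinear_scale: "sublinear q \<Longrightarrow> c \<ge> 0 \<Longrightarrow> q (c *\<^sub>R x) = c * q x"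
  by (simp add: sublinear_def)

lemma sublinear_zero: "sublinear q \<Longrightarrow> q 0 = 0"
  using sublinear_scale[of q 0 0] by simp

lemma sublinear_minus_ge: "sublinear q \<Longrightarrow> - q (- x) \<le> q x"
  using sublinear_add[of q x "- x"] sublinear_zero[of q] by simp

text \<open>
  One inequality suffices for positive homogeneity: the reverse one is the same inequality for the
  inverse scalar, and the scalars \<open>2\<close> and \<open>1/2\<close> settle the value at the origin.
\<close>

lemma sublinearI:
  assumes add: "\<And>x y. q (x + y) \<le> q x + q y"
    and scale: "\<And>c x. c > 0 \<Longrightarrow> q (c *\<^sub>R x) \<le> c * q x"
  shows "sublinear q"
proof -
  have zero: "q 0 = 0"
    using scale[of 2 0] scale[of "1/2" 0] by simp
  have "q (c *\<^sub>R x) = c * q x" if "c \<ge> 0" for c x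
  proof (cases "c = 0")
    case False
    with that have "c > 0" by simp
    then have "q x \<le> inverse c * q (c *\<^sub>R x)"
      using scale[of "inverse c" "c *\<^sub>R x"] by simp
    with \<open>c > 0\<close> have "c * q x \<le> q (c *\<^sub>R x)"
      by (simp add: field_simps)
    then show ?thesis
      using scale[OF \<open>c > 0\<close>, of x] by simp
  qed (simp add: zero)
  with add show ?thesis
    by (simp add: sublinear_def)
qed

text \<open>
  The common source of the sublinear functionals used below: distances to a subspace, lowered
  functionals and infima of chains are all infima of families of this kind.
\<close>

lemma sublinear_INF:
  fixes g :: "'i \<Rightarrow> 'a::real_vector \<Rightarrow> real"
  assumes ne: "I \<noteq> {}"
    and bdd: "\<And>x. bdd_below ((\<lambda>i. g i x) ` I)"
    and add: "\<And>i j x y. i \<in> I \<Longrightarrow> j \<in> I \<Longrightarrow> \<exists>k\<in>I. g k (x + y) \<le> g i x + g j y"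
    and scale: "\<And>i c x. i \<in> I \<Longrightarrow> c > 0 \<Longrightarrow> \<exists>k\<in>I. g k (c *\<^sub>R x) \<le> c * g i x"
  shows "sublinear (\<lambda>x. INF i\<in>I. g i x)"
proof (rule sublinearI)
  fix x y
  have le: "(INF k\<in>I. g k (x + y)) \<le> g i x + g j y" if "i \<in> I" "j \<in> I" for i j
    using add[OF that, of x y] cINF_lower[OF bdd] by (meson order_trans)
  have "(INF k\<in>I. g k (x + y)) - g i x \<le> (INF j\<in>I. g j y)" if "i \<in> I" for i
    using le[OF that] by (intro cINF_greatest[OF ne]) (simp add: algebra_simps)
  then have "(INF k\<in>I. g k (x + y)) - (INF j\<in>I. g j y) \<le> (INF i\<in>I. g i x)"
    by (intro cINF_greatest[OF ne]) (simp add: algebra_simps)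
  then show "(INF k\<in>I. g k (x + y)) \<le> (INF i\<in>I. g i x) + (INF j\<in>I. g j y)"
    by simp
next
  fix c :: real and x
  assume c: "c > 0"
  have "(INF k\<in>I. g k (c *\<^sub>R x)) \<le> c * g i x" if "i \<in> I" for i
    using scale[OF that c, of x] cINF_lower[OF bdd] by (meson order_trans)
  then have "(INF k\<in>I. g k (c *\<^sub>R x)) / c \<le> (INF i\<in>I. g i x)"
    using c by (intro cINF_greatest[OF ne]) (simp add: field_simps)
  then show "(INF k\<in>I. g k (c *\<^sub>R x)) \<le> c * (INF i\<in>I. g i x)"
    using c by (simp add: field_simps)
qed

text \<open>
  A sublinear functional \<open>q\<close> can be lowered to \<open>x \<mapsto> inf {q (x + t y) - t q y | t \<ge> 0}\<close>, which is the
  largest sublinear functional below \<open>q\<close> with value at most \<open>- q y\<close> at \<open>- y\<close>. Passing to it forces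
  the linearity relation between \<open>y\<close> and \<open>- y\<close>.
\<close>

lemma sublinear_lower_in_direction:
  fixes y :: "'a::real_vector"
  assumes q: "sublinear q"
  obtains r where "sublinear r" "\<And>x. r x \<le> q x" "r (- y) \<le> - q y"
proof
  let ?g = "\<lambda>t x. q (x + t *\<^sub>R y) - t * q y"
  let ?r = "\<lambda>x. INF t\<in>{0..}. ?g t x"
  have bdd: "bdd_below ((\<lambda>t. ?g t x) ` {0..})" for x
  proof (rule bdd_belowI2)
    fix t :: real assume "t \<in> {0..}"
    then have "t * q y = q ((x + t *\<^sub>R y) + (- x))"
      by (simp add: sublinear_scale[OF q])
    also have "\<dots> \<le> q (x + t *\<^sub>R y) + q (- x)"
      by (rule sublinear_add[OF q])
    finally show "- q (- x) \<le> ?g t x" by simp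
  qed
  show "sublinear ?r"
  proof (rule sublinear_INF[OF _ bdd])
    fix s t :: real and x z
    assume "s \<in> {0..}" "t \<in> {0..}"
    moreover have "?g (s + t) (x + z) \<le> ?g s x + ?g t z"
      using sublinear_add[OF q, of "x + s *\<^sub>R y" "z + t *\<^sub>R y"] by (simp add: algebra_simps)
    ultimately show "\<exists>k\<in>{0..}. ?g k (x + z) \<le> ?g s x + ?g t z"
      by (intro bexI[of _ "s + t"]) auto
  next
    fix t c :: real and x
    assume "t \<in> {0..}" "c > 0"
    moreover from this have "?g (c * t) (c *\<^sub>R x) \<le> c * ?g t x"
      using sublinear_scale[OF q, of c "x + t *\<^sub>R y"] by (simp add: algebra_simps)
    ultimately show "\<exists>k\<in>{0..}. ?g k (c *\<^sub>R x) \<le> c * ?g t x"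
      by (intro bexI[of _ "c * t"]) auto
  qed simp
  show "?r x \<le> q x" for x
    using cINF_lower[OF bdd, of 0 x] by simp
  show "?r (- y) \<le> - q y"
    using cINF_lower[OF bdd, of 1 "- y"] sublinear_zero[OF q] by simp
qed

lemma linear_if_sublinear_odd:
  assumes q: "sublinear q" and odd: "\<And>x. q (- x) = - q x"
  shows "linear q"
proof (rule linearI)
  fix x y
  have "- q (x + y) \<le> - q x + - q y"
    using sublinear_add[OF q, of "- x" "- y"] odd[of "x + y"] by (simp add: odd)
  then show "q (x + y) = q x + q y"
    using sublinear_add[OF q, of x y] by simp
next
  fix c :: real and x
  show "q (c *\<^sub>R x) = c *\<^sub>R q x"
  proof (cases "c \<ge> 0")
    case False
    then have "q ((- c) *\<^sub>R x) = - c * q x"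
      by (intro sublinear_scale[OF q]) simp
    then show ?thesis
      using odd[of "c *\<^sub>R x"] by simp
  qed (simp add: sublinear_scale[OF q])
qed

text \<open>
  The bound \<open>- q (- x) \<le> q x\<close> keeps a chain of sublinear functionals below \<open>p\<close> above \<open>- p (- x)\<close>, so
  pointwise infima of chains exist and Zorn's lemma applies.
\<close>

lemma minimal_sublinear_exists:
  fixes p :: "'a::real_vector \<Rightarrow> real"
  assumes p: "sublinear p"
  obtains q where "sublinear q" "q \<le> p" "\<And>r. sublinear r \<Longrightarrow> r \<le> q \<Longrightarrow> r = q"
proof -
  let ?A = "{q. sublinear q \<and> q \<le> p}"
  have "\<exists>q\<in>?A. \<forall>r\<in>?A. r \<le> q \<longrightarrow> r = q"
  proof (rule predicate_Zorn)
    show "partial_order_on ?A (relation_of (\<lambda>q r. r \<le> q) ?A)"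
      by (rule partial_order_on_relation_ofI) auto
  next
    fix C assume C: "C \<in> Chains (relation_of (\<lambda>q r. r \<le> q) ?A)"
    then have CA: "sublinear q" "q \<le> p" if "q \<in> C" for q
      using that by (auto simp: Chains_def relation_of_def)
    from C have chain: "q \<le> r \<or> r \<le> q" if "q \<in> C" "r \<in> C" for q r
      using that by (auto simp: Chains_def relation_of_def)
    show "\<exists>u\<in>?A. \<forall>q\<in>C. u \<le> q"
    proof (cases "C = {}")
      case True
      with p show ?thesis by blast
    next
      case False
      let ?u = "\<lambda>x. INF q\<in>C. q x"
      have bdd: "bdd_below ((\<lambda>q. q x) ` C)" for x
      proof (rule bdd_belowI2)
        fix q assume "q \<in> C"
        then show "- p (- x) \<le> q x"
          using sublinear_minus_ge[OF CA(1), of q x] le_funD[OF CA(2), of q "- x"] by simp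
      qed
      have lower: "?u \<le> q" if "q \<in> C" for q
        using cINF_lower[OF bdd that] by (simp add: le_fun_def)
      have "sublinear ?u"
      proof (rule sublinear_INF[OF False bdd])
        fix q r and x y :: 'a
        assume qr: "q \<in> C" "r \<in> C"
        then consider "q \<le> r" | "r \<le> q" using chain by blast
        then show "\<exists>k\<in>C. k (x + y) \<le> q x + r y"
        proof cases
          case 1
          then have "q (x + y) \<le> q x + r y"
            using sublinear_add[OF CA(1)[OF qr(1)], of x y] le_funD[OF 1, of y] by simp
          with qr show ?thesis by blast
        next
          case 2
          then have "r (x + y) \<le> q x + r y"
            using sublinear_add[OF CA(1)[OF qr(2)], of x y] le_funD[OF 2, of x] by simp
          with qr show ?thesis by blast
        qed
      next
        fix q and c :: real and x :: 'a
        assume "q \<in> C" "c > 0"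
        then show "\<exists>k\<in>C. k (c *\<^sub>R x) \<le> c * q x"
          by (intro bexI[of _ q]) (simp_all add: sublinear_scale[OF CA(1)])
      qed
      moreover have "?u \<le> p"
        using False lower CA(2) by (meson ex_in_conv order_trans)
      ultimately show ?thesis
        using lower by (intro bexI[of _ ?u]) auto
    qed
  qed
  then obtain q where q: "sublinear q" "q \<le> p" and min: "\<forall>r\<in>?A. r \<le> q \<longrightarrow> r = q"
    by blast
  show ?thesis
  proof (rule that[OF q])
    fix r assume r: "sublinear r" "r \<le> q"
    have "r \<le> p" using r(2) q(2) by (rule order_trans)
    with r show "r = q" using min by blast
  qed
qed

section \<open>The Hahn-Banach theorem\<close>

text \<open>
  First \<open>p\<close> is lowered in the direction of \<open>y\<close>, so that every functional below the result attains
  \<open>p y\<close> at \<open>y\<close>. A minimal sublinear functional below that is odd, because it agrees with each of its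
  own lowerings, hence linear.
\<close>

lemma Hahn_Banach_sublinear:
  fixes p :: "'a::real_vector \<Rightarrow> real"
  assumes p: "sublinear p"
  obtains f where "linear f" "\<And>x. f x \<le> p x" "f y = p y"
proof -
  obtain r where r: "sublinear r" "\<And>x. r x \<le> p x" "r (- y) \<le> - p y"
    using sublinear_lower_in_direction[OF p] by blast
  obtain f where f: "sublinear f" "f \<le> r" and min: "\<And>q. sublinear q \<Longrightarrow> q \<le> f \<Longrightarrow> q = f"
    using minimal_sublinear_exists[OF r(1)] by blast
  have odd: "f (- x) = - f x" for x
  proof -
    obtain q where q: "sublinear q" "\<And>z. q z \<le> f z" "q (- x) \<le> - f x"
      using sublinear_lower_in_direction[OF f(1)] by blast
    then have "q = f" by (intro min) (auto simp: le_fun_def)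
    with q(3) show ?thesis
      using sublinear_minus_ge[OF f(1), of x] by simp
  qed
  have le: "f x \<le> p x" for x
    using le_funD[OF f(2), of x] r(2)[of x] by simp
  have "f (- y) \<le> - p y"
    using le_funD[OF f(2), of "- y"] r(3) by simp
  then have "f y = p y"
    using odd[of y] le[of y] by simp
  with linear_if_sublinear_odd[OF f(1) odd] le show ?thesis
    by (rule that)
qed

lemma sublinear_infdist_subspace:
  fixes D :: "'a::real_normed_vector set"
  assumes D: "subspace D"
  shows "sublinear (\<lambda>x. infdist x D)"
proof -
  have ne: "D \<noteq> {}"
    using subspace_0[OF D] by blast
  have "sublinear (\<lambda>x. INF d\<in>D. dist x d)"
  proof (rule sublinear_INF[OF ne])
    show "bdd_below ((\<lambda>d. dist x d) ` D)" for x
      by (rule bdd_belowI2[of _ 0]) simp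
  next
    fix d e x y assume "d \<in> D" "e \<in> D"
    then show "\<exists>k\<in>D. dist (x + y) k \<le> dist x d + dist y e"
      by (intro bexI[of _ "d + e"]) (auto simp: dist_norm norm_diff_triangle_ineq subspace_add[OF D])
  next
    fix d x and c :: real assume "d \<in> D" "c > 0"
    then show "\<exists>k\<in>D. dist (c *\<^sub>R x) k \<le> c * dist x d"
      by (intro bexI[of _ "c *\<^sub>R d"]) (auto simp: dist_norm subspace_scale[OF D] simp flip: scaleR_diff_right)
  qed
  then show ?thesis
    by (simp add: infdist_notempty[OF ne])
qed

text \<open>
  A linear functional dominated by the distance to \<open>D\<close> vanishes on \<open>D\<close> and has norm at most one; if
  it also attains that distance at \<open>x\<close>, it separates \<open>x\<close> from \<open>D\<close>.
\<close>

lemma closed_subspace_separation: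
  fixes D :: "'a::real_normed_vector set"
  assumes D: "subspace D" "closed D" and x: "x \<notin> D"
  obtains f where "f \<in> annihilator D" "blinfun_apply f x \<noteq> 0"
proof -
  have D0: "0 \<in> D" using subspace_0[OF D(1)] .
  obtain f where f: "linear f" "\<And>z. f z \<le> infdist z D" "f x = infdist x D"
    using Hahn_Banach_sublinear[OF sublinear_infdist_subspace[OF D(1)]] by blast
  have "f z \<le> norm z" for z
    using f(2)[of z] infdist_le[OF D0, of z] by simp
  from this this[of "- z" for z] have "norm (f z) \<le> norm z * 1" for z
    by (simp add: linear_neg[OF f(1)] abs_le_iff)
  then have bl: "bounded_linear f"
    using f(1) by (intro bounded_linear_intro[of f 1]) (auto simp: linear_add linear_scale)
  have "f z = 0" if "z \<in> D" for z
    using f(2)[of z] f(2)[of "- z"] that subspace_neg[OF D(1) that]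
    by (simp add: linear_neg[OF f(1)])
  then have "Blinfun f \<in> annihilator D"
    by (simp add: annihilator_def bounded_linear_Blinfun_apply[OF bl])
  moreover have "blinfun_apply (Blinfun f) x \<noteq> 0"
    using in_closed_iff_infdist_zero[OF D(2), of x] D0 x
    by (auto simp: bounded_linear_Blinfun_apply[OF bl] f(3))
  ultimately show ?thesis by (rule that)
qed

section \<open>Linear monotone operators\<close>

lemma slope_zero_if_nonneg:
  fixes a b :: real
  assumes "\<And>t. 0 \<le> a + t * b"
  shows "b = 0"
  using assms[of "- (a + 1) / b"] by (cases "b = 0") auto

lemma linear_coeff_zero_if_nonneg:
  fixes b c :: real
  assumes "\<And>t. 0 \<le> t * b + t\<^sup>2 * c"
  shows "b = 0"
proof (rule ccontr)
  assume b: "b \<noteq> 0"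
  \<comment> \<open>At \<open>t = - b / k\<close> the expression is \<open>b\<^sup>2 (c - k) / k\<^sup>2\<close>, so any positive \<open>k > c\<close> gives a
    negative value, whatever the sign of \<open>c\<close>.\<close>
  define k where "k = \<bar>c\<bar> + 1"
  have k: "k > 0" "c < k" by (auto simp: k_def)
  have "(- b / k) * b + (- b / k)\<^sup>2 * c = b\<^sup>2 * (c - k) / k\<^sup>2"
    using k by (simp add: field_simps power2_eq_square)
  also have "\<dots> < 0"
    using b k by (intro divide_neg_pos mult_pos_neg) auto
  finally show False
    using assms[of "- b / k"] by simp
qed

text \<open>
  Two points \<open>(x, x')\<close> and \<open>(y, y')\<close> are tested with the cycle \<open>x, y, \<dots>, y\<close>, whose repeated points
  contribute zero.
\<close>

lemma p_monotone_imp_monotone: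
  assumes "p \<ge> 1" and T: "p_monotone p T"
  shows "p_monotone 1 T"
  unfolding p_monotone_1_iff
proof (intro allI impI)
  fix x x' y y' assume xy: "(x, x') \<in> T \<and> (y, y') \<in> T"
  obtain m where m: "p = Suc m" using \<open>p \<ge> 1\<close> by (cases p) auto
  let ?z = "\<lambda>i. if i = 0 \<or> i = Suc p then x else y"
  let ?z' = "\<lambda>i::nat. if i = 0 then x' else y'"
  let ?s = "\<lambda>i. blinfun_apply (?z' i) (?z (Suc i) - ?z i)"
  have "(\<Sum>i=0..p. ?s i) \<le> 0"
    using xy by (intro T[unfolded p_monotone_def, rule_format]) auto
  moreover have "(\<Sum>i=0..p. ?s i) = ?s 0 + (\<Sum>i=1..m. ?s i) + ?s (Suc m)"
    by (simp add: m sum.atLeast_Suc_atMost)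
  moreover have "(\<Sum>i=1..m. ?s i) = 0"
    by (rule sum.neutral) (auto simp: m)
  ultimately show "0 \<le> blinfun_apply (x' - y') (x - y)"
    by (simp add: m blinfun.diff_left blinfun.diff_right)
qed

lemma subspace_Domain:
  assumes T: "subspace T"
  shows "subspace (Domain T)"
proof (rule subspaceI)
  show "0 \<in> Domain T"
    using subspace_0[OF T] by (auto simp: zero_prod_def)
next
  fix x y assume "x \<in> Domain T" "y \<in> Domain T"
  then show "x + y \<in> Domain T"
    using subspace_add[OF T] by fastforce
next
  fix c x assume "x \<in> Domain T"
  then show "c *\<^sub>R x \<in> Domain T"
    using subspace_scale[OF T] by fastforce
qed

lemma monotone_linear_zero_image_subset:
  assumes T: "subspace T" and mono: "p_monotone 1 T"
  shows "T `` {0} \<subseteq> annihilator (Domain T)"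
proof
  fix y' assume "y' \<in> T `` {0}"
  then have y: "(0, y') \<in> T" by simp
  have "blinfun_apply y' x = 0" if x: "(x, x') \<in> T" for x x'
  proof -
    have "0 \<le> t * (- blinfun_apply y' x) + t\<^sup>2 * blinfun_apply x' x" for t
    proof -
      have "(t *\<^sub>R x, t *\<^sub>R x') \<in> T"
        using subspace_scale[OF T x, of t] by simp
      then have "0 \<le> blinfun_apply (t *\<^sub>R x' - y') (t *\<^sub>R x - 0)"
        using mono y unfolding p_monotone_1_iff by blast
      then show ?thesis
        by (simp add: blinfun.bilinear_simps algebra_simps power2_eq_square)
    qed
    then have "- blinfun_apply y' x = 0"
      by (rule linear_coeff_zero_if_nonneg)
    then show ?thesis by simp
  qed
  then show "y' \<in> annihilator (Domain T)"
    by (auto simp: annihilator_def)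
qed

text \<open>
  The sums in the definition of \<open>p\<close>-monotonicity pair the values only with differences of points of
  the domain, hence do not see the added annihilating parts.
\<close>

lemma p_monotone_add_annihilator:
  assumes T: "subspace T" and mono: "p_monotone p T"
  shows "p_monotone p {(x, x' + z') |x x' z'. (x, x') \<in> T \<and> z' \<in> annihilator (Domain T)}"
    (is "p_monotone p ?S")
  unfolding p_monotone_def
proof (intro allI impI)
  fix x y' assume *: "(\<forall>i\<le>p. (x i, y' i) \<in> ?S) \<and> x (Suc p) = x 0"
  then have "\<forall>i\<in>{..p}. \<exists>x'. (x i, x') \<in> T \<and> y' i - x' \<in> annihilator (Domain T)"
    by fastforce
  then obtain x' where x': "\<And>i. i \<le> p \<Longrightarrow> (x i, x' i) \<in> T"
      "\<And>i. i \<le> p \<Longrightarrow> y' i - x' i \<in> annihilator (Domain T)"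
    by (metis atMost_iff)
  have dom: "x i \<in> Domain T" if "i \<le> Suc p" for i
    using x'(1)[of i] x'(1)[of 0] * that by (cases "i = Suc p") auto
  have "blinfun_apply (y' i) (x (Suc i) - x i) = blinfun_apply (x' i) (x (Suc i) - x i)"
    if "i \<le> p" for i
  proof -
    have "x (Suc i) - x i \<in> Domain T"
      using that by (intro subspace_diff[OF subspace_Domain[OF T]] dom) auto
    then have "blinfun_apply (y' i - x' i) (x (Suc i) - x i) = 0"
      using x'(2)[OF that] by (simp add: annihilator_def)
    then show ?thesis
      by (simp add: blinfun.diff_left)
  qed
  then have "(\<Sum>i=0..p. blinfun_apply (y' i) (x (Suc i) - x i))
      = (\<Sum>i=0..p. blinfun_apply (x' i) (x (Suc i) - x i))"
    by (intro sum.cong) auto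
  also have "\<dots> \<le> 0"
    using mono x'(1) * unfolding p_monotone_def by blast
  finally show "(\<Sum>i=0..p. blinfun_apply (y' i) (x (Suc i) - x i)) \<le> 0" .
qed

lemma maximal_p_monotone_annihilator_subset:
  assumes T: "subspace T" and max: "maximal_p_monotone p T"
  shows "annihilator (Domain T) \<subseteq> T `` {0}"
proof
  fix z' assume z': "z' \<in> annihilator (Domain T)"
  let ?S = "{(x, x' + z') |x x' z'. (x, x') \<in> T \<and> z' \<in> annihilator (Domain T)}"
  have "0 \<in> annihilator (Domain T)"
    by (simp add: annihilator_def)
  then have "T \<subseteq> ?S"
    by force
  moreover have "p_monotone p ?S"
    using max by (intro p_monotone_add_annihilator[OF T]) (simp add: maximal_p_monotone_def)
  ultimately have "?S = T"
    using max by (simp add: maximal_p_monotone_def)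
  moreover have "(0, 0) \<in> T"
    using subspace_0[OF T] by (simp add: zero_prod_def)
  then have "(0, 0 + z') \<in> ?S"
    using z' by blast
  ultimately show "z' \<in> T `` {0}"
    by simp
qed

lemma in_Domain_if_monotonically_related:
  assumes T: "subspace T" and cl: "closed (Domain T)"
    and T0: "annihilator (Domain T) \<subseteq> T `` {0}"
    and rel: "\<And>y y'. (y, y') \<in> T \<Longrightarrow> 0 \<le> blinfun_apply (x' - y') (x - y)"
  shows "x \<in> Domain T"
proof (rule ccontr)
  assume "x \<notin> Domain T"
  then obtain f where f: "f \<in> annihilator (Domain T)" "blinfun_apply f x \<noteq> 0"
    using closed_subspace_separation[OF subspace_Domain[OF T] cl] by blast
  then have "(0, f) \<in> T" using T0 by blast
  then have "(0, t *\<^sub>R f) \<in> T" for t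
    using subspace_scale[OF T, of "(0, f)" t] by simp
  then have "0 \<le> blinfun_apply x' x + t * (- blinfun_apply f x)" for t
    using rel[of 0 "t *\<^sub>R f"] by (simp add: blinfun.bilinear_simps)
  then have "- blinfun_apply f x = 0"
    by (rule slope_zero_if_nonneg)
  with f(2) show False by simp
qed

lemma diff_in_annihilator_if_monotonically_related:
  assumes T: "subspace T" and x: "(x, x0') \<in> T"
    and rel: "\<And>y y'. (y, y') \<in> T \<Longrightarrow> 0 \<le> blinfun_apply (x' - y') (x - y)"
  shows "x' - x0' \<in> annihilator (Domain T)"
proof -
  have "blinfun_apply (x' - x0') u = 0" if u: "(u, u') \<in> T" for u u'
  proof (rule linear_coeff_zero_if_nonneg)
    fix t
    have "(x - t *\<^sub>R u, x0' - t *\<^sub>R u') \<in> T"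
      using subspace_diff[OF T x subspace_scale[OF T u, of t]] by simp
    from rel[OF this]
    show "0 \<le> t * blinfun_apply (x' - x0') u + t\<^sup>2 * blinfun_apply u' u"
      by (simp add: blinfun.bilinear_simps algebra_simps power2_eq_square)
  qed
  then show ?thesis
    by (auto simp: annihilator_def)
qed

theorem linear_monotone_closed_domain_maximal:
  fixes T :: "'a::real_normed_vector operator"
  assumes T: "subspace T" and mono: "p_monotone 1 T" and cl: "closed (Domain T)"
    and T0: "annihilator (Domain T) \<subseteq> T `` {0}"
  shows "maximal_monotone T"
  unfolding maximal_monotone_def maximal_p_monotone_def
proof (intro conjI allI impI)
  fix S assume S: "p_monotone 1 S \<and> T \<subseteq> S"
  have "(x, x') \<in> T" if xS: "(x, x') \<in> S" for x x'
  proof -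
    have rel: "0 \<le> blinfun_apply (x' - y') (x - y)" if "(y, y') \<in> T" for y y'
      using S xS that unfolding p_monotone_1_iff by blast
    obtain x0' where x0: "(x, x0') \<in> T"
      using in_Domain_if_monotonically_related[OF T cl T0 rel] by blast
    then have "(0, x' - x0') \<in> T"
      using diff_in_annihilator_if_monotonically_related[OF T x0 rel] T0 by blast
    then show ?thesis
      using subspace_add[OF T x0] by fastforce
  qed
  with S show "S = T" by auto
qed (rule mono)

theorem theorem3p4:
  fixes T :: "'a::banach operator" and p :: nat
  assumes "p \<ge> 1" and "subspace T"
  shows "(maximal_p_monotone p T \<longrightarrow> T `` {0} = annihilator (Domain T)) \<and>
    (p_monotone p T \<and> closed (Domain T) \<and> T `` {0} = annihilator (Domain T) \<longrightarrow>
      maximal_monotone T \<and> maximal_p_monotone p T)"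
proof (intro conjI impI)
  assume max: "maximal_p_monotone p T"
  then have "p_monotone 1 T"
    using p_monotone_imp_monotone[OF assms(1)] by (auto simp: maximal_p_monotone_def)
  then show "T `` {0} = annihilator (Domain T)"
    using monotone_linear_zero_image_subset[OF assms(2)]
      maximal_p_monotone_annihilator_subset[OF assms(2) max] by blast
next
  assume *: "p_monotone p T \<and> closed (Domain T) \<and> T `` {0} = annihilator (Domain T)"
  then show max: "maximal_monotone T"
    using p_monotone_imp_monotone[OF assms(1)]
    by (intro linear_monotone_closed_domain_maximal[OF assms(2)]) auto
  show "maximal_p_monotone p T"
    using * max p_monotone_imp_monotone[OF assms(1)]
    by (auto simp: maximal_monotone_def maximal_p_monotone_def)
qed

end
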